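(* Let $S$ be an inverse semigroup. Then the following are equivalent: (1) $S$ is a weak semilattice (with respect to its natural partial order); (2) for every non-degenerate action $\theta\colon S\to I_X$ on a locally compact Hausdorff space $X$ such that $X_e$ is clopen for all $e\in E(S)$, the groupoid of germs $S\ltimes_\theta X$ is Hausdorff; (3) the universal groupoid $\mathscr G(S)$ is Hausdorff. In particular, every groupoid of germs for an ample action of $S$ is Hausdorff if and only if $S$ is a weak semilattice.
   Context: An inverse semigroup is a semigroup $S$ such that each $s\in S$ has a unique $s^*$ with $ss^*s=s$, $s^*ss^*=s^*$. $E(S)$ is its commutative semigroup of idempotents, ordered by $e\le f$ iff $ef=e$; the natural partial order on $S$ is $s\le t$ iff $s=et$ for some $e\in E(S)$. A poset is a weak semilattice if the intersection of any two principal downsets $p^{\downarrow}=\{q\mid q\le p\}$ is finitely generated as a downset (i.e. a finite union of principal downsets; the empty downset is generated by the empty set). For a locally compact Hausdorff space $X$, $I_X$ is the inverse semigroup of homeomorphisms between open subsets of $X$. An action of $S$ on $X$ is a homomorphism $\theta\colon S\to I_X$; write $sx=\theta_s(x)$ and $X_e$ for the domain of $\theta_e$, $e\in E(S)$ (so $\theta_s$ has domain $X_{s^*s}$). It is non-degenerate if $X=\bigcup_{e\in E(S)}X_e$. It is ample if it is non-degenerate, $X$ has a basis of compact open sets, and each $X_e$ is compact open. The groupoid of germs $S\ltimes_\theta X$ of a non-degenerate action is the set of classes $[s,x]$ of pairs $(s,x)$ with $x\in X_{s^*s}$, where $(s,x)\sim(t,y)$ iff $x=y$ and there is $u\le s,t$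 with $x\in X_{u^*u}$. Its topology has as basis the sets $(s,U)=\{[s,x]\mid x\in U\}$ with $U\subseteq X_{s^*s}$ open. The product $[s,x][t,y]=[st,y]$ is defined iff $ty=x$, and $[s,x]^{-1}=[s^*,sx]$. $\widehat{E(S)}$ is the space of non-zero semilattice homomorphisms $\varphi\colon E(S)\to\{0,1\}$ with the subspace topology from $\{0,1\}^{E(S)}$; $D(e)=\{\varphi\mid\varphi(e)=1\}$. The spectral action of $S$ on $\widehat{E(S)}$ sends $s$ to the homeomorphism $D(s^*s)\to D(ss^* )$, $(s\varphi)(e)=\varphi(s^*es)$. The universal groupoid $\mathscr G(S)$ is the groupoid of germs of the spectral action. *)

theory Defs
  imports "HOL-Analysis.Analysis"
begin

section \<open>Inverse semigroups and their natural partial order\<close>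

class inverse_semigroup = semigroup_mult +
  assumes ex1_star: "\<exists>!t. s * t * s = s \<and> t * s * t = t"

definition star :: "'s::inverse_semigroup \<Rightarrow> 's" where
  "star s = (THE t. s * t * s = s \<and> t * s * t = t)"

definition idempotents :: "'s::inverse_semigroup set" where
  "idempotents = {e. e * e = e}"

definition natural_le :: "'s::inverse_semigroup \<Rightarrow> 's \<Rightarrow> bool" where
  "natural_le s t \<longleftrightarrow> (\<exists>e\<in>idempotents. s = e * t)"

definition principal_downset :: "('p \<Rightarrow> 'p \<Rightarrow> bool) \<Rightarrow> 'p \<Rightarrow> 'p set" where
  "principal_downset le p = {q. le q p}"

definition weak_semilattice :: "('p \<Rightarrow> 'p \<Rightarrow> bool) \<Rightarrow> bool" where
  "weak_semilattice le \<longleftrightarrow>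
     (\<forall>p q. \<exists>F. finite F \<and>
        principal_downset le p \<inter> principal_downset le q = (\<Union>r\<in>F. principal_downset le r))"


section \<open>Actions by partial homeomorphisms\<close>

text \<open>A partial map of a space is a function into an option type; the product of the
  inverse semigroup of partial homeomorphisms is then \<^term>\<open>(\<circ>\<^sub>m)\<close>, whose domain is
  the set of points where the composite makes sense.\<close>

definition partial_homeos :: "'x topology \<Rightarrow> ('x \<Rightarrow> 'x option) set" where
  "partial_homeos X =
     {f. openin X (dom f) \<and> openin X (ran f) \<and>
         homeomorphic_map (subtopology X (dom f)) (subtopology X (ran f)) (\<lambda>x. the (f x))}"

definition semigroup_action ::
    "'x topology \<Rightarrow> ('s::inverse_semigroup \<Rightarrow> 'x \<Rightarrow> 'x option) \<Rightarrow> bool" where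
  "semigroup_action X \<theta> \<longleftrightarrow>
     (\<forall>s. \<theta> s \<in> partial_homeos X) \<and> (\<forall>s t. \<theta> (s * t) = \<theta> s \<circ>\<^sub>m \<theta> t)"

definition nondegenerate_action ::
    "'x topology \<Rightarrow> ('s::inverse_semigroup \<Rightarrow> 'x \<Rightarrow> 'x option) \<Rightarrow> bool" where
  "nondegenerate_action X \<theta> \<longleftrightarrow>
     semigroup_action X \<theta> \<and> topspace X = (\<Union>e\<in>idempotents. dom (\<theta> e))"

definition ample_action ::
    "'x topology \<Rightarrow> ('s::inverse_semigroup \<Rightarrow> 'x \<Rightarrow> 'x option) \<Rightarrow> bool" where
  "ample_action X \<theta> \<longleftrightarrow>
     nondegenerate_action X \<theta> \<and>
     (\<exists>\<B>. (\<forall>V\<in>\<B>. openin X V \<and> compactin X V) \<and>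
          (\<forall>U x. openin X U \<and> x \<in> U \<longrightarrow> (\<exists>V\<in>\<B>. x \<in> V \<and> V \<subseteq> U))) \<and>
     (\<forall>e\<in>idempotents. compactin X (dom (\<theta> e)) \<and> openin X (dom (\<theta> e)))"


section \<open>The groupoid of germs\<close>

text \<open>The arrows of a topological groupoid are the points of its topology; the
  multiplication returns \<^term>\<open>None\<close> on non-composable pairs.\<close>

record 'g topological_groupoid =
  arrow_topology :: "'g topology"
  arrow_mult :: "'g \<Rightarrow> 'g \<Rightarrow> 'g option"
  arrow_inv :: "'g \<Rightarrow> 'g"

definition Hausdorff_groupoid :: "'g topological_groupoid \<Rightarrow> bool" where
  "Hausdorff_groupoid G \<longleftrightarrow> Hausdorff_space (arrow_topology G)"

definition germ_pairs :: "('s::inverse_semigroup \<Rightarrow> 'x \<Rightarrow> 'x option) \<Rightarrow> ('s \<times> 'x) set" where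
  "germ_pairs \<theta> = {(s, x). x \<in> dom (\<theta> (star s * s))}"

definition germ_rel ::
    "('s::inverse_semigroup \<Rightarrow> 'x \<Rightarrow> 'x option) \<Rightarrow> (('s \<times> 'x) \<times> ('s \<times> 'x)) set" where
  "germ_rel \<theta> =
     {((s, x), (t, y)). (s, x) \<in> germ_pairs \<theta> \<and> (t, y) \<in> germ_pairs \<theta> \<and> x = y \<and>
        (\<exists>u. natural_le u s \<and> natural_le u t \<and> x \<in> dom (\<theta> (star u * u)))}"

definition germ ::
    "('s::inverse_semigroup \<Rightarrow> 'x \<Rightarrow> 'x option) \<Rightarrow> 's \<Rightarrow> 'x \<Rightarrow> ('s \<times> 'x) set" where
  "germ \<theta> s x = germ_rel \<theta> `` {(s, x)}"

definition germ_basic ::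
    "('s::inverse_semigroup \<Rightarrow> 'x \<Rightarrow> 'x option) \<Rightarrow> 's \<Rightarrow> 'x set \<Rightarrow> ('s \<times> 'x) set set" where
  "germ_basic \<theta> s U = germ \<theta> s ` U"

text \<open>The sets \<^term>\<open>germ_basic \<theta> s U\<close> cover the germs and, because germs are compatible
  with passing to smaller elements, they form a basis and not just a subbasis of the
  topology they generate.\<close>

definition germ_topology ::
    "'x topology \<Rightarrow> ('s::inverse_semigroup \<Rightarrow> 'x \<Rightarrow> 'x option) \<Rightarrow> ('s \<times> 'x) set topology" where
  "germ_topology X \<theta> =
     topology_generated_by
       {germ_basic \<theta> s U | s U. openin X U \<and> U \<subseteq> dom (\<theta> (star s * s))}"

definition germ_composable ::
    "('s::inverse_semigroup \<Rightarrow> 'x \<Rightarrow> 'x option) \<Rightarrow>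
     ('s \<times> 'x) set \<Rightarrow> ('s \<times> 'x) set \<Rightarrow> ('s \<times> 'x) set \<Rightarrow> bool" where
  "germ_composable \<theta> a b c \<longleftrightarrow>
     (\<exists>s x t y. (s, x) \<in> germ_pairs \<theta> \<and> (t, y) \<in> germ_pairs \<theta> \<and>
        a = germ \<theta> s x \<and> b = germ \<theta> t y \<and> \<theta> t y = Some x \<and> c = germ \<theta> (s * t) y)"

definition germ_groupoid ::
    "'x topology \<Rightarrow> ('s::inverse_semigroup \<Rightarrow> 'x \<Rightarrow> 'x option) \<Rightarrow>
     ('s \<times> 'x) set topological_groupoid" where
  "germ_groupoid X \<theta> =
     \<lparr>arrow_topology = germ_topology X \<theta>,
      arrow_mult = (\<lambda>a b. if \<exists>c. germ_composable \<theta> a b c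
                           then Some (THE c. germ_composable \<theta> a b c) else None),
      arrow_inv = (\<lambda>a. THE b. \<exists>s x. (s, x) \<in> germ_pairs \<theta> \<and>
                           a = germ \<theta> s x \<and> b = germ \<theta> (star s) (the (\<theta> s x)))\<rparr>"


section \<open>The spectral action and the universal groupoid\<close>

text \<open>A map from the idempotents to \<open>{0,1}\<close> is encoded as an extensional function on
  \<^term>\<open>idempotents\<close> with values in the discrete space \<^typ>\<open>bool\<close>, where \<^term>\<open>True\<close>
  stands for 1 and the product of \<open>{0,1}\<close> is conjunction.\<close>

definition characters :: "('s::inverse_semigroup \<Rightarrow> bool) set" where
  "characters =
     {\<phi> \<in> extensional idempotents.
        (\<forall>e\<in>idempotents. \<forall>f\<in>idempotents. \<phi> (e * f) \<longleftrightarrow> \<phi> e \<and> \<phi> f) \<and>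
        (\<exists>e\<in>idempotents. \<phi> e)}"

definition spectrum :: "('s::inverse_semigroup \<Rightarrow> bool) topology" where
  "spectrum =
     subtopology (product_topology (\<lambda>e. discrete_topology UNIV) idempotents) characters"

definition spectral_domain :: "'s::inverse_semigroup \<Rightarrow> ('s \<Rightarrow> bool) set" where
  "spectral_domain e = {\<phi> \<in> characters. \<phi> e}"

definition spectral_action ::
    "'s::inverse_semigroup \<Rightarrow> ('s \<Rightarrow> bool) \<Rightarrow> ('s \<Rightarrow> bool) option" where
  "spectral_action s \<phi> =
     (if \<phi> \<in> spectral_domain (star s * s)
      then Some (\<lambda>e\<in>idempotents. \<phi> (star s * e * s)) else None)"

definition universal_groupoid ::
    "('s::inverse_semigroup \<times> ('s \<Rightarrow> bool)) set topological_groupoid" where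
  "universal_groupoid = germ_groupoid spectrum spectral_action"

end

theory Submission
  imports Defs
begin

text \<open>
  Two germs \<open>[s,x] \<noteq> [t,x]\<close> over the same point can only fail to be separated because of points
  close to \<open>x\<close> lying in some \<open>X\<^bsub>u\<^sup>*u\<^esub>\<close> with \<open>u \<le> s, t\<close>. If finitely many \<open>r\<close> generate the common
  lower bounds of \<open>s\<close> and \<open>t\<close>, removing the finitely many closed sets \<open>X\<^bsub>r\<^sup>*r\<^esub>\<close>, none of which contains
  \<open>x\<close>, separates the germs.

  Conversely, if the universal groupoid is Hausdorff, then the set of \<open>\<phi>\<close> with \<open>[s,\<phi>] = [t,\<phi>]\<close> is closed in
  the compact set \<open>D(s\<^sup>*s) \<inter> D(t\<^sup>*t)\<close>. It is the union of the open sets \<open>D(u\<^sup>*u)\<close> with \<open>u \<le> s, t\<close>, so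
  finitely many of these cover it, and evaluating the cover at the principal character of \<open>v\<^sup>*v\<close>
  shows that every \<open>v \<le> s, t\<close> lies below one of the finitely many \<open>u\<close>. Since the spectral action is
  ample, every version of the Hausdorff condition applies to it.
\<close>

section \<open>Inverse semigroups\<close>

lemma star_inverse:
  fixes s :: "'s::inverse_semigroup"
  shows "s * star s * s = s" and "star s * s * star s = star s"
  using theI'[OF ex1_star[of s]] unfolding star_def by auto

lemma star_unique:
  fixes s :: "'s::inverse_semigroup"
  assumes "s * t * s = s" and "t * s * t = t"
  shows "star s = t"
  using ex1_star[of s] star_inverse[of s] assms by blast

lemma star_star [simp]: "star (star s) = (s::'s::inverse_semigroup)"
  by (simp add: star_inverse star_unique)

lemma star_idempotent:
  fixes e :: "'s::inverse_semigroup"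
  assumes "e \<in> idempotents"
  shows "star e = e"
  using assms by (intro star_unique) (simp_all add: idempotents_def)

lemma star_mult_self_idempotent:
  fixes s :: "'s::inverse_semigroup"
  shows "star s * s \<in> idempotents" and "s * star s \<in> idempotents"
  unfolding idempotents_def by (simp_all flip: mult.assoc add: star_inverse)

lemma idempotent_mult_self: "e \<in> idempotents \<Longrightarrow> e * e = e"
  by (simp add: idempotents_def)

lemma idempotents_mult:
  fixes e f :: "'s::inverse_semigroup"
  assumes e: "e \<in> idempotents" and f: "f \<in> idempotents"
  shows "e * f \<in> idempotents"
proof -
  define x where "x = star (e * f)"
  have x1: "e * f * x * (e * f) = e * f" and x2: "x * (e * f) * x = x"
    using star_inverse[of "e * f"] by (simp_all add: x_def)
  have e1: "e * (e * z) = e * z" and f1: "f * (f * z) = f * z" for z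
    using e f by (simp_all add: idempotents_def flip: mult.assoc)
  \<comment> \<open>\<open>f x e\<close> is a second inverse of \<open>e f\<close>, hence equals \<open>x\<close>; so \<open>x\<close> is idempotent,
    and so is its inverse \<open>e f\<close>.\<close>
  have "star (e * f) = f * x * e"
  proof (rule star_unique)
    show "e * f * (f * x * e) * (e * f) = e * f"
      using x1 by (simp add: mult.assoc e1 f1)
    have "f * x * e * (e * f) * (f * x * e) = f * (x * (e * f) * x) * e"
      by (simp add: mult.assoc e1 f1)
    then show "f * x * e * (e * f) * (f * x * e) = f * x * e"
      by (simp only: x2)
  qed
  then have x: "x = f * x * e" by (simp add: x_def)
  have "x * x = f * (x * (e * f) * x) * e"
    by (subst (1 2) x) (simp add: mult.assoc)
  then have "x * x = x"
    using x by (simp only: x2)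
  then have "star x = x"
    by (intro star_idempotent) (simp add: idempotents_def)
  then have "e * f = x"
    unfolding x_def by simp
  with \<open>x * x = x\<close> show ?thesis
    by (simp add: idempotents_def)
qed

text \<open>The products \<open>e * f\<close> and \<open>f * e\<close> are inverse to each other,
  while the idempotent \<open>e * f\<close> is its own inverse; uniqueness of inverses identifies
  them.\<close>

lemma idempotents_commute:
  fixes e f :: "'s::inverse_semigroup"
  assumes e: "e \<in> idempotents" and f: "f \<in> idempotents"
  shows "e * f = f * e"
proof -
  have e1: "e * (e * z) = e * z" and f1: "f * (f * z) = f * z" for z
    using e f by (simp_all add: idempotents_def flip: mult.assoc)
  have ef: "e * (f * (e * f)) = e * f" and fe: "f * (e * (f * e)) = f * e"
    using idempotents_mult[OF e f] idempotents_mult[OF f e]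
    by (simp_all add: idempotents_def mult.assoc)
  have "star (e * f) = f * e"
    by (rule star_unique) (simp_all add: mult.assoc e1 f1 ef fe)
  then show ?thesis
    using star_idempotent[OF idempotents_mult[OF e f]] by simp
qed

text \<open>Both inverse laws reduce to those of \<open>s\<close> and \<open>t\<close> once the
  idempotents \<open>t * star t\<close> and \<open>star s * s\<close> in the middle are
  swapped.\<close>

lemma star_mult:
  fixes s t :: "'s::inverse_semigroup"
  shows "star (s * t) = star t * star s"
proof (rule star_unique)
  have c: "(t * star t) * (star s * s) = (star s * s) * (t * star t)"
    by (intro idempotents_commute star_mult_self_idempotent)
  have "s * t * (star t * star s) * (s * t) = s * ((t * star t) * (star s * s)) * t"
    by (simp add: mult.assoc)
  also have "\<dots> = (s * star s * s) * (t * star t * t)"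
    by (simp only: c) (simp add: mult.assoc)
  finally show "s * t * (star t * star s) * (s * t) = s * t"
    by (simp only: star_inverse)
  have "star t * star s * (s * t) * (star t * star s) = star t * ((star s * s) * (t * star t)) * star s"
    by (simp add: mult.assoc)
  also have "\<dots> = (star t * t * star t) * (star s * s * star s)"
    by (simp only: c[symmetric]) (simp add: mult.assoc)
  finally show "star t * star s * (s * t) * (star t * star s) = star t * star s"
    by (simp only: star_inverse)
qed

text \<open>The conjugate is \<open>star (e * s) * (e * s)\<close>, the domain idempotent of
  \<open>e * s\<close>.\<close>

lemma conjugate_idempotent:
  fixes s :: "'s::inverse_semigroup"
  assumes "e \<in> idempotents"
  shows "star s * e * s \<in> idempotents"
proof -
  have "star s * e * s = star (e * s) * (e * s)"
    using assms by (simp add: star_mult star_idempotent idempotent_mult_self mult.assoc flip: mult.assoc[of e e])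
  then show ?thesis
    by (simp add: star_mult_self_idempotent)
qed

lemma conjugate_mult:
  fixes s :: "'s::inverse_semigroup"
  assumes "e \<in> idempotents" and "f \<in> idempotents"
  shows "star s * (e * f) * s = (star s * e * s) * (star s * f * s)"
proof -
  have "(star s * e * s) * (star s * f * s) = star s * (e * (s * star s)) * f * s"
    by (simp add: mult.assoc)
  also have "\<dots> = star s * ((s * star s) * e) * f * s"
    using assms by (simp only: idempotents_commute star_mult_self_idempotent)
  also have "\<dots> = (star s * s * star s) * (e * f) * s"
    by (simp add: mult.assoc)
  finally show ?thesis
    by (simp only: star_inverse)
qed

section \<open>The natural partial order as restriction to domain idempotents\<close>

text \<open>An idempotent moves across \<open>s\<close> by conjugation:
  \<open>e * s = s * (star s * e * s)\<close> and
  \<open>s * f = (s * f * star s) * s\<close>.\<close>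

lemma natural_le_iff_right:
  fixes u s :: "'s::inverse_semigroup"
  shows "natural_le u s \<longleftrightarrow> (\<exists>f\<in>idempotents. u = s * f)"
proof
  assume "natural_le u s"
  then obtain e where e: "e \<in> idempotents" "u = e * s"
    unfolding natural_le_def by blast
  have "s * (star s * e * s) = (s * star s) * e * s"
    by (simp add: mult.assoc)
  also have "\<dots> = e * (s * star s) * s"
    using e by (simp only: idempotents_commute star_mult_self_idempotent)
  also have "\<dots> = e * (s * star s * s)"
    by (simp add: mult.assoc)
  finally show "\<exists>f\<in>idempotents. u = s * f"
    using e conjugate_idempotent[of e s] by (metis star_inverse(1))
next
  assume "\<exists>f\<in>idempotents. u = s * f"
  then obtain f where f: "f \<in> idempotents" "u = s * f" by blast
  have "(s * f * star s) * s = s * (f * (star s * s))"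
    by (simp add: mult.assoc)
  also have "\<dots> = s * ((star s * s) * f)"
    using f by (simp only: idempotents_commute star_mult_self_idempotent)
  also have "\<dots> = (s * star s * s) * f"
    by (simp add: mult.assoc)
  finally show "natural_le u s"
    using f conjugate_idempotent[of f "star s"] unfolding natural_le_def
    by (metis star_inverse(1) star_star)
qed

text \<open>An element below \<open>s\<close> is the restriction of \<open>s\<close> to its own
  domain idempotent, so it is determined by \<open>s\<close> and that idempotent.\<close>

lemma natural_le_eq:
  fixes u s :: "'s::inverse_semigroup"
  assumes "natural_le u s"
  shows "u = s * (star u * u)"
proof -
  obtain f where f: "f \<in> idempotents" "u = s * f"
    using assms natural_le_iff_right by blast
  have "s * (star u * u) = s * (star u * (u * f))"
    using f by (simp add: mult.assoc idempotent_mult_self)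
  also have "\<dots> = s * ((star u * u) * f)"
    by (simp add: mult.assoc)
  also have "\<dots> = s * (f * (star u * u))"
    using f(1) by (simp only: idempotents_commute star_mult_self_idempotent)
  also have "\<dots> = u * star u * u"
    using f(2) by (simp add: mult.assoc)
  finally show ?thesis
    by (simp add: star_inverse)
qed

lemma natural_le_refl [simp]: "natural_le s (s::'s::inverse_semigroup)"
  unfolding natural_le_def
  by (rule bexI[of _ "s * star s"]) (simp_all add: star_inverse star_mult_self_idempotent)

lemma natural_le_trans:
  fixes u s :: "'s::inverse_semigroup"
  shows "natural_le u s \<Longrightarrow> natural_le s t \<Longrightarrow> natural_le u t"
  unfolding natural_le_def by (metis idempotents_mult mult.assoc)

lemma natural_le_star_mult_self:
  fixes u s :: "'s::inverse_semigroup"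
  assumes "natural_le u s"
  shows "(star u * u) * (star s * s) = star u * u"
proof -
  obtain e where e: "e \<in> idempotents" "u = e * s"
    using assms natural_le_def by blast
  have "(star u * u) * (star s * s) = star u * e * (s * star s * s)"
    using e by (simp add: mult.assoc)
  then show ?thesis
    using e by (simp only: star_inverse) (simp add: mult.assoc)
qed

text \<open>Restricting \<open>s\<close> to the product of both domain idempotents gives
  \<open>u * (star v * v)\<close> and, as idempotents commute, also \<open>v * (star u * u)\<close>.
  This supplies the common lower bound behind transitivity of germ equality.\<close>

lemma natural_le_common_restriction:
  fixes u v s :: "'s::inverse_semigroup"
  assumes "natural_le u s" and "natural_le v s"
  shows "natural_le (s * ((star u * u) * (star v * v))) u"
    and "natural_le (s * ((star u * u) * (star v * v))) v"
proof -
  have "s * ((star u * u) * (star v * v)) = s * (star u * u) * (star v * v)"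
    by (simp only: mult.assoc)
  also have "\<dots> = u * (star v * v)"
    by (simp only: natural_le_eq[OF assms(1), symmetric])
  finally have "s * ((star u * u) * (star v * v)) = u * (star v * v)" .
  then show "natural_le (s * ((star u * u) * (star v * v))) u"
    using natural_le_iff_right star_mult_self_idempotent by blast
  have "s * ((star u * u) * (star v * v)) = s * ((star v * v) * (star u * u))"
    by (simp only: idempotents_commute star_mult_self_idempotent)
  also have "\<dots> = s * (star v * v) * (star u * u)"
    by (simp only: mult.assoc)
  also have "\<dots> = v * (star u * u)"
    by (simp only: natural_le_eq[OF assms(2), symmetric])
  finally show "natural_le (s * ((star u * u) * (star v * v))) v"
    using natural_le_iff_right star_mult_self_idempotent by blast
qed

text \<open>The second hypothesis says that \<open>f\<close> lies below \<open>star s * s\<close>;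
  then the domain idempotent of the restriction is exactly \<open>f\<close>.\<close>

lemma star_mult_self_restriction:
  fixes u s :: "'s::inverse_semigroup"
  assumes "f \<in> idempotents" and "f * (star s * s) = f"
  shows "star (s * f) * (s * f) = f"
proof -
  have "star (s * f) * (s * f) = f * ((star s * s) * f)"
    using assms(1) by (simp add: star_mult star_idempotent mult.assoc)
  also have "\<dots> = f * (f * (star s * s))"
    using assms(1) by (simp only: idempotents_commute star_mult_self_idempotent)
  finally show ?thesis
    using assms by (simp add: idempotent_mult_self)
qed

section \<open>Groupoids of germs\<close>

lemma semigroup_action_mult:
  "semigroup_action X \<theta> \<Longrightarrow> \<theta> (s * t) = \<theta> s \<circ>\<^sub>m \<theta> t"
  by (simp add: semigroup_action_def)

lemma semigroup_action_openin_dom: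
  "semigroup_action X \<theta> \<Longrightarrow> openin X (dom (\<theta> s))"
  by (simp add: semigroup_action_def partial_homeos_def)

lemma semigroup_action_inj:
  assumes "semigroup_action X \<theta>" and "\<theta> s x = Some z" and "\<theta> s y = Some z"
  shows "x = y"
proof -
  have "inj_on (\<lambda>x. the (\<theta> s x)) (topspace X \<inter> dom (\<theta> s))"
    using assms(1) homeomorphic_imp_injective_map
    unfolding semigroup_action_def partial_homeos_def by fastforce
  moreover have "dom (\<theta> s) \<subseteq> topspace X"
    using assms(1) by (intro openin_subset semigroup_action_openin_dom)
  ultimately show ?thesis
    using assms(2,3) by (auto simp: inj_on_def dom_def subset_eq)
qed

text \<open>From \<open>e * e = e\<close> one gets that \<open>\<theta> e\<close> sends both
  \<open>x\<close> and \<open>y\<close> to \<open>y\<close>, and it is injective.\<close>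

lemma semigroup_action_idempotent:
  assumes "semigroup_action X \<theta>" and "e \<in> idempotents" and "\<theta> e x = Some y"
  shows "y = x"
proof -
  have "(\<theta> e \<circ>\<^sub>m \<theta> e) x = Some y"
    using assms by (simp add: idempotent_mult_self flip: semigroup_action_mult)
  then have "\<theta> e y = Some y"
    using assms(3) by simp
  then show ?thesis
    using assms(3) by (rule semigroup_action_inj[OF assms(1)])
qed

text \<open>Where \<open>\<theta> f\<close> is defined it fixes the point, so composing with it only
  intersects domains.\<close>

lemma dom_action_mult_idempotents:
  assumes "semigroup_action X \<theta>" and "f \<in> idempotents"
  shows "dom (\<theta> (e * f)) = dom (\<theta> e) \<inter> dom (\<theta> f)"
proof -
  have "x \<in> dom (\<theta> (e * f)) \<longleftrightarrow> x \<in> dom (\<theta> e) \<and> x \<in> dom (\<theta> f)" for x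
  proof (cases "\<theta> f x")
    case None
    then show ?thesis
      by (simp add: semigroup_action_mult[OF assms(1)] dom_def)
  next
    case (Some y)
    then have "\<theta> f x = Some x"
      using semigroup_action_idempotent[OF assms] by blast
    then show ?thesis
      by (simp add: semigroup_action_mult[OF assms(1)] dom_def)
  qed
  then show ?thesis by blast
qed

lemma dom_action_mono:
  assumes "semigroup_action X \<theta>" and "natural_le u s"
  shows "dom (\<theta> (star u * u)) \<subseteq> dom (\<theta> (star s * s))"
  using dom_action_mult_idempotents[OF assms(1) star_mult_self_idempotent(1), of "star u * u" s]
  unfolding natural_le_star_mult_self[OF assms(2)] by blast

text \<open>The witnesses \<open>u\<close> and \<open>v\<close> of the two relations both lie below
  the middle element \<open>t\<close>. The restriction of \<open>t\<close> to the product of their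
  domain idempotents lies below both, and its domain still contains the base point.\<close>

lemma germ_rel_trans:
  assumes \<theta>: "semigroup_action X \<theta>"
    and "(p, q) \<in> germ_rel \<theta>" and "(q, r) \<in> germ_rel \<theta>"
  shows "(p, r) \<in> germ_rel \<theta>"
proof -
  obtain s t w x where p: "p = (s, x)" "q = (t, x)" "r = (w, x)"
    and pairs: "(s, x) \<in> germ_pairs \<theta>" "(w, x) \<in> germ_pairs \<theta>"
    using assms(2,3) unfolding germ_rel_def by fastforce
  obtain u where u: "natural_le u s" "natural_le u t" "x \<in> dom (\<theta> (star u * u))"
    using assms(2) unfolding p germ_rel_def by blast
  obtain v where v: "natural_le v t" "natural_le v w" "x \<in> dom (\<theta> (star v * v))"
    using assms(3) unfolding p germ_rel_def by blast
  let ?f = "(star u * u) * (star v * v)"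
  have "natural_le (t * ?f) u" "natural_le (t * ?f) v"
    using natural_le_common_restriction u(2) v(1) by blast+
  then have "natural_le (t * ?f) s" "natural_le (t * ?f) w"
    using u(1) v(2) natural_le_trans by blast+
  moreover have "?f * (star t * t) = ?f"
    by (simp only: mult.assoc[of "star u * u" "star v * v"] natural_le_star_mult_self[OF v(1)])
  then have "star (t * ?f) * (t * ?f) = ?f"
    by (intro star_mult_self_restriction idempotents_mult star_mult_self_idempotent)
  then have "x \<in> dom (\<theta> (star (t * ?f) * (t * ?f)))"
    using u(3) v(3) dom_action_mult_idempotents[OF \<theta> star_mult_self_idempotent(1), of "star u * u" v]
    by simp
  ultimately show ?thesis
    using pairs unfolding p germ_rel_def by blast
qed

lemma germ_rel_sym: "(p, q) \<in> germ_rel \<theta> \<Longrightarrow> (q, p) \<in> germ_rel \<theta>"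
  unfolding germ_rel_def by auto

lemma germ_eq_iff:
  assumes \<theta>: "semigroup_action X \<theta>"
    and s: "(s, x) \<in> germ_pairs \<theta>" and t: "(t, y) \<in> germ_pairs \<theta>"
  shows "germ \<theta> s x = germ \<theta> t y \<longleftrightarrow>
    x = y \<and> (\<exists>u. natural_le u s \<and> natural_le u t \<and> x \<in> dom (\<theta> (star u * u)))"
proof -
  have "((t, y), (t, y)) \<in> germ_rel \<theta>"
    using t natural_le_refl unfolding germ_rel_def germ_pairs_def by blast
  then have "germ \<theta> s x = germ \<theta> t y \<longleftrightarrow> ((s, x), (t, y)) \<in> germ_rel \<theta>"
    using germ_rel_trans[OF \<theta>] germ_rel_sym[of _ _ \<theta>] unfolding germ_def by blast
  then show ?thesis
    using s t unfolding germ_rel_def by blast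
qed

lemma openin_germ_basic:
  assumes "openin X U" and "U \<subseteq> dom (\<theta> (star s * s))"
  shows "openin (germ_topology X \<theta>) (germ_basic \<theta> s U)"
  unfolding germ_topology_def using assms by (intro topology_generated_by_Basis) blast

lemma topspace_germ_topology:
  assumes "semigroup_action X \<theta>"
  shows "topspace (germ_topology X \<theta>) = {germ \<theta> s x | s x. (s, x) \<in> germ_pairs \<theta>}"
proof -
  have "\<Union>{germ_basic \<theta> s U | s U. openin X U \<and> U \<subseteq> dom (\<theta> (star s * s))} =
      (\<Union>s. germ \<theta> s ` dom (\<theta> (star s * s)))"
    (is "\<Union>?\<B> = _")
  proof
    show "\<Union>?\<B> \<subseteq> (\<Union>s. germ \<theta> s ` dom (\<theta> (star s * s)))"
      unfolding germ_basic_def by blast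
    have "germ_basic \<theta> s (dom (\<theta> (star s * s))) \<in> ?\<B>" for s
      using semigroup_action_openin_dom[OF assms] by blast
    then show "(\<Union>s. germ \<theta> s ` dom (\<theta> (star s * s))) \<subseteq> \<Union>?\<B>"
      unfolding germ_basic_def by (intro UN_least Union_upper)
  qed
  then show ?thesis
    unfolding germ_topology_def topology_generated_by_topspace germ_pairs_def by auto
qed

text \<open>The preimage of a basic set given by \<open>r\<close> and \<open>U\<close> is the union
  of the open sets \<open>U \<inter> dom (\<theta> (star u * u))\<close> over the common lower
  bounds \<open>u\<close> of \<open>s\<close> and \<open>r\<close>.\<close>

lemma continuous_map_germ:
  assumes \<theta>: "semigroup_action X \<theta>"
  shows "continuous_map (subtopology X (dom (\<theta> (star s * s)))) (germ_topology X \<theta>) (germ \<theta> s)"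
    (is "continuous_map ?D _ _")
  unfolding germ_topology_def
proof (rule continuous_on_generated_topo)
  have sub: "dom (\<theta> w) \<subseteq> topspace X" for w
    using \<theta> by (intro openin_subset semigroup_action_openin_dom)
  have top: "topspace ?D = dom (\<theta> (star s * s))"
    using sub[of "star s * s"] by auto
  fix B assume "B \<in> {germ_basic \<theta> r U | r U. openin X U \<and> U \<subseteq> dom (\<theta> (star r * r))}"
  then obtain r U where B: "B = germ_basic \<theta> r U" "openin X U" "U \<subseteq> dom (\<theta> (star r * r))"
    by blast
  have "germ \<theta> s x \<in> B \<longleftrightarrow>
      x \<in> U \<and> (\<exists>u. natural_le u s \<and> natural_le u r \<and> x \<in> dom (\<theta> (star u * u)))"
    if "x \<in> dom (\<theta> (star s * s))" for x
    using germ_eq_iff[OF \<theta>, of s x r] that B(3)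
    by (auto simp: B(1) germ_basic_def germ_pairs_def image_iff subset_eq Bex_def)
  \<comment> \<open>As \<open>u\<close> lies below \<open>s\<close>, the union over all
    \<open>u\<close> already stays inside the domain of the section.\<close>
  moreover have le: "x \<in> dom (\<theta> (star s * s))" if "natural_le u s" "x \<in> dom (\<theta> (star u * u))" for u x
    using dom_action_mono[OF \<theta> that(1)] that(2) by (rule subsetD)
  ultimately have "germ \<theta> s -` B \<inter> topspace ?D =
      (\<Union>u\<in>{u. natural_le u s \<and> natural_le u r}. U \<inter> dom (\<theta> (star u * u)))"
    unfolding top by (intro set_eqI) (simp only: vimage_eq Int_iff UN_iff mem_Collect_eq, blast)
  moreover have "openin X \<dots>"
    using B(2) semigroup_action_openin_dom[OF \<theta>] by (intro openin_Union) auto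
  moreover have "\<dots> \<subseteq> dom (\<theta> (star s * s))"
    using le by (simp only: UN_subset_iff) blast
  ultimately show "openin ?D (germ \<theta> s -` B \<inter> topspace ?D)"
    using semigroup_action_openin_dom[OF \<theta>] by (simp add: openin_open_subtopology)
next
  show "germ \<theta> s ` topspace ?D
      \<subseteq> \<Union>{germ_basic \<theta> s U | s U. openin X U \<and> U \<subseteq> dom (\<theta> (star s * s))}"
    using semigroup_action_openin_dom[OF \<theta>, of "star s * s"] by (auto simp: germ_basic_def)
qed

section \<open>Separation of germs, and the equalizer of two germ sections\<close>

lemma Hausdorff_germ_topology:
  assumes \<theta>: "semigroup_action X \<theta>" and X: "Hausdorff_space X"
    and closed: "\<And>e. e \<in> idempotents \<Longrightarrow> closedin X (dom (\<theta> e))"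
    and ws: "weak_semilattice (natural_le :: 's::inverse_semigroup \<Rightarrow> 's \<Rightarrow> bool)"
  shows "Hausdorff_space (germ_topology X (\<theta> :: 's \<Rightarrow> 'x \<Rightarrow> 'x option))"
  unfolding Hausdorff_space_def
proof (intro allI impI, elim conjE)
  fix a b
  assume "a \<in> topspace (germ_topology X \<theta>)" "b \<in> topspace (germ_topology X \<theta>)" and "a \<noteq> b"
  then obtain s x t y where a: "a = germ \<theta> s x" "(s, x) \<in> germ_pairs \<theta>"
    and b: "b = germ \<theta> t y" "(t, y) \<in> germ_pairs \<theta>"
    unfolding topspace_germ_topology[OF \<theta>] by blast
  let ?S = "dom (\<theta> (star s * s))" and ?T = "dom (\<theta> (star t * t))"
  have op: "openin X ?S" "openin X ?T"
    using \<theta> by (simp_all add: semigroup_action_openin_dom)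
  have xy: "x \<in> ?S" "y \<in> ?T" "x \<in> topspace X" "y \<in> topspace X"
    using a b op[THEN openin_subset] by (auto simp: germ_pairs_def)
  \<comment> \<open>Equal germs have equal base points, so disjointness of two basic sets need only
    be checked over points common to \<open>U\<close> and \<open>V\<close>.\<close>
  have sep: "\<exists>U V. openin (germ_topology X \<theta>) U \<and> openin (germ_topology X \<theta>) V \<and>
      a \<in> U \<and> b \<in> V \<and> disjnt U V"
    if "openin X U" "openin X V" "x \<in> U" "y \<in> V" "U \<subseteq> ?S" "V \<subseteq> ?T"
      and disj: "\<And>z. z \<in> U \<Longrightarrow> z \<in> V \<Longrightarrow> germ \<theta> s z \<noteq> germ \<theta> t z" for U V
  proof (intro exI conjI)
    show "openin (germ_topology X \<theta>) (germ_basic \<theta> s U)" "openin (germ_topology X \<theta>) (germ_basic \<theta> t V)"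
      using that by (simp_all add: openin_germ_basic)
    show "a \<in> germ_basic \<theta> s U" "b \<in> germ_basic \<theta> t V"
      using a b that by (auto simp: germ_basic_def)
    show "disjnt (germ_basic \<theta> s U) (germ_basic \<theta> t V)"
    proof -
      have "germ \<theta> s z \<noteq> germ \<theta> t w" if zw: "z \<in> U" "w \<in> V" for z w
      proof
        assume eq: "germ \<theta> s z = germ \<theta> t w"
        moreover have "(s, z) \<in> germ_pairs \<theta>" "(t, w) \<in> germ_pairs \<theta>"
          using zw \<open>U \<subseteq> ?S\<close> \<open>V \<subseteq> ?T\<close> by (auto simp: germ_pairs_def)
        ultimately have "z = w"
          using germ_eq_iff[OF \<theta>] by blast
        then show False
          using eq zw disj by blast
      qed
      then show ?thesis
        unfolding germ_basic_def disjnt_def by blast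
    qed
  qed
  show "\<exists>U V. openin (germ_topology X \<theta>) U \<and> openin (germ_topology X \<theta>) V \<and>
      a \<in> U \<and> b \<in> V \<and> disjnt U V"
  proof (cases "x = y")
    case False
    then obtain U V where "openin X U" "openin X V" "x \<in> U" "y \<in> V" "disjnt U V"
      using X xy unfolding Hausdorff_space_def by blast
    then show ?thesis
      using op xy by (intro sep[of "U \<inter> ?S" "V \<inter> ?T"]) (auto simp: disjnt_iff)
  next
    case True
    obtain F where F: "finite F"
      "principal_downset natural_le s \<inter> principal_downset natural_le t =
        (\<Union>r\<in>F. principal_downset natural_le r)"
      using ws unfolding weak_semilattice_def by blast
    have le: "natural_le u s \<and> natural_le u t \<longleftrightarrow> (\<exists>r\<in>F. natural_le u r)" for u
      using F(2) unfolding principal_downset_def by blast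
    \<comment> \<open>This finite union of closed sets is where the germs of \<open>s\<close> and
      \<open>t\<close> agree: a common lower bound \<open>u\<close> lies below some \<open>r\<close>
      in \<open>F\<close>, and domains are monotone. Off \<open>C\<close>, a single neighbourhood
      serves for both germs.\<close>
    define C where "C = (\<Union>r\<in>F. dom (\<theta> (star r * r)))"
    have "closedin X C"
      unfolding C_def using F(1) closed star_mult_self_idempotent by (intro closedin_Union) auto
    moreover have "x \<notin> C"
    proof
      assume "x \<in> C"
      then obtain r where "r \<in> F" "x \<in> dom (\<theta> (star r * r))"
        unfolding C_def by blast
      moreover have "natural_le r s" "natural_le r t"
        using le[of r] \<open>r \<in> F\<close> natural_le_refl by blast+
      ultimately show False
        using \<open>a \<noteq> b\<close> a b True germ_eq_iff[OF \<theta>] by blast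
    qed
    moreover have "germ \<theta> s z \<noteq> germ \<theta> t z" if z: "z \<in> ?S" "z \<in> ?T" "z \<notin> C" for z
    proof
      assume "germ \<theta> s z = germ \<theta> t z"
      then obtain u where u: "natural_le u s" "natural_le u t" "z \<in> dom (\<theta> (star u * u))"
        using germ_eq_iff[OF \<theta>] z by (auto simp: germ_pairs_def)
      then obtain r where "r \<in> F" "natural_le u r"
        using le by blast
      then show False
        using u(3) z(3) dom_action_mono[OF \<theta>] unfolding C_def by blast
    qed
    ultimately show ?thesis
      using op xy True by (intro sep[of "?S \<inter> ?T - C" "?S \<inter> ?T - C"]) (auto intro: openin_diff)
  qed
qed

text \<open>The two sections \<open>germ \<theta> s\<close> and \<open>germ \<theta> t\<close> are
  continuous into a Hausdorff space, so they agree on a closed set; by the description of germ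
  equality this set is the stated union.\<close>

lemma closedin_germ_equalizer:
  assumes \<theta>: "semigroup_action X \<theta>" and H: "Hausdorff_space (germ_topology X \<theta>)"
  shows "closedin (subtopology X (dom (\<theta> (star s * s)) \<inter> dom (\<theta> (star t * t))))
    (\<Union>u\<in>{u. natural_le u s \<and> natural_le u t}. dom (\<theta> (star u * u)))"
    (is "closedin ?Y ?K")
proof -
  let ?S = "dom (\<theta> (star s * s))" and ?T = "dom (\<theta> (star t * t))"
  have "continuous_map ?Y (germ_topology X \<theta>) (germ \<theta> s)" "continuous_map ?Y (germ_topology X \<theta>) (germ \<theta> t)"
    using continuous_map_germ[OF \<theta>] by (blast intro: continuous_map_from_subtopology_mono)+
  then have "closedin ?Y {x \<in> topspace ?Y. germ \<theta> s x = germ \<theta> t x}"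
    using H by (intro closedin_continuous_maps_eq)
  moreover have "topspace ?Y = ?S \<inter> ?T"
    using \<theta>[THEN semigroup_action_openin_dom, THEN openin_subset] by auto
  moreover have "{x \<in> ?S \<inter> ?T. germ \<theta> s x = germ \<theta> t x} = ?K"
  proof -
    have "germ \<theta> s x = germ \<theta> t x \<longleftrightarrow> x \<in> ?K" if "x \<in> ?S \<inter> ?T" for x
      using germ_eq_iff[OF \<theta>, of s x t x] that by (simp only: germ_pairs_def) blast
    moreover have "?K \<subseteq> ?S \<inter> ?T"
    proof (intro UN_least Int_greatest)
      fix u assume "u \<in> {u. natural_le u s \<and> natural_le u t}"
      then show "dom (\<theta> (star u * u)) \<subseteq> ?S" "dom (\<theta> (star u * u)) \<subseteq> ?T"
        using dom_action_mono[OF \<theta>] by auto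
    qed
    ultimately show ?thesis by blast
  qed
  ultimately show ?thesis by (simp only:)
qed

section \<open>The spectral action\<close>

lemma character_mult:
  "\<phi> \<in> characters \<Longrightarrow> e \<in> idempotents \<Longrightarrow> f \<in> idempotents \<Longrightarrow> \<phi> (e * f) \<longleftrightarrow> \<phi> e \<and> \<phi> f"
  by (simp add: characters_def)

lemma character_ext:
  assumes "\<phi> \<in> characters" and "\<psi> \<in> characters" and "\<And>e. e \<in> idempotents \<Longrightarrow> \<phi> e = \<psi> e"
  shows "\<phi> = \<psi>"
  using assms by (intro extensionalityI[of \<phi> idempotents]) (auto simp: characters_def)

lemma dom_spectral_action: "dom (spectral_action s) = spectral_domain (star s * s)"
  by (auto simp: spectral_action_def split: if_splits)

lemma spectral_action_in_domain:
  assumes "\<phi> \<in> spectral_domain (star s * s)"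
  shows "(\<lambda>e\<in>idempotents. \<phi> (star s * e * s)) \<in> spectral_domain (s * star s)"
proof -
  have \<phi>: "\<phi> \<in> characters" "\<phi> (star s * s)"
    using assms by (simp_all add: spectral_domain_def)
  have "star s * (s * star s) * s = star s * s"
    by (simp add: star_inverse flip: mult.assoc)
  then have "(\<lambda>e\<in>idempotents. \<phi> (star s * e * s)) (s * star s)"
    using \<phi>(2) star_mult_self_idempotent(2)[of s] by simp
  moreover from this have "\<exists>e\<in>idempotents. (\<lambda>e\<in>idempotents. \<phi> (star s * e * s)) e"
    using star_mult_self_idempotent(2) by blast
  then have "(\<lambda>e\<in>idempotents. \<phi> (star s * e * s)) \<in> characters"
    using \<phi>(1)
    by (simp add: characters_def idempotents_mult conjugate_mult conjugate_idempotent)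
  ultimately show ?thesis
    by (simp add: spectral_domain_def)
qed

text \<open>Acting by \<open>s\<close> and then by \<open>star s\<close> evaluates
  \<open>\<phi>\<close> at \<open>(star s * s) * (e * (star s * s))\<close>, and the outer factors
  have value 1. This provides the inverse homeomorphism.\<close>

lemma spectral_action_star:
  assumes "\<phi> \<in> spectral_domain (star s * s)"
  shows "spectral_action (star s) (the (spectral_action s \<phi>)) = Some \<phi>"
proof -
  let ?\<psi> = "\<lambda>e\<in>idempotents. \<phi> (star s * e * s)"
  have \<phi>: "\<phi> \<in> characters" "\<phi> (star s * s)"
    using assms by (simp_all add: spectral_domain_def)
  have \<psi>: "?\<psi> \<in> spectral_domain (star (star s) * star s)"
    using spectral_action_in_domain[OF assms] by simp
  have "(\<lambda>e\<in>idempotents. ?\<psi> (s * e * star s)) = \<phi>"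
  proof (rule character_ext[OF _ \<phi>(1)])
    show "(\<lambda>e\<in>idempotents. ?\<psi> (s * e * star s)) \<in> characters"
      using spectral_action_in_domain[OF \<psi>] by (simp add: spectral_domain_def)
    fix e :: 'a assume e: "e \<in> idempotents"
    have "s * e * star s \<in> idempotents"
      using conjugate_idempotent[OF e, of "star s"] by simp
    moreover have "star s * (s * e * star s) * s = (star s * s) * (e * (star s * s))"
      by (simp add: mult.assoc)
    ultimately show "(\<lambda>e\<in>idempotents. ?\<psi> (s * e * star s)) e = \<phi> e"
      using e \<phi> by (simp add: character_mult idempotents_mult star_mult_self_idempotent)
  qed
  then show ?thesis
    using assms \<psi> by (simp add: spectral_action_def)
qed

lemma ran_spectral_action: "ran (spectral_action s) = spectral_domain (s * star s)"
proof
  show "ran (spectral_action s) \<subseteq> spectral_domain (s * star s)"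
    by (auto simp: ran_def spectral_action_def spectral_action_in_domain split: if_splits)
  show "spectral_domain (s * star s) \<subseteq> ran (spectral_action s)"
    using spectral_action_star[of _ "star s"] by (auto simp: ran_def)
qed

lemma spectral_action_mult: "spectral_action (s * t) = spectral_action s \<circ>\<^sub>m spectral_action t"
proof
  fix \<phi> :: "'a \<Rightarrow> bool"
  have "star t * (star s * s) * t * (star t * t) = star t * (star s * s) * (t * star t * t)"
    by (simp add: mult.assoc)
  \<comment> \<open>The domain idempotent of \<open>s * t\<close> lies below that of
    \<open>t\<close>, so a character outside the domain of \<open>t\<close> is also outside that of
    \<open>s * t\<close>.\<close>
  then have le: "star t * (star s * s) * t = star t * (star s * s) * t * (star t * t)"
    by (simp add: star_inverse)
  let ?\<psi> = "\<lambda>e\<in>idempotents. \<phi> (star t * e * t)"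
  have idem: "star t * (star s * s) * t \<in> idempotents"
    by (intro conjugate_idempotent star_mult_self_idempotent)
  have st: "star (s * t) * (s * t) = star t * (star s * s) * t"
    by (simp add: star_mult mult.assoc)
  show "spectral_action (s * t) \<phi> = (spectral_action s \<circ>\<^sub>m spectral_action t) \<phi>"
  proof (cases "\<phi> \<in> spectral_domain (star t * t)")
    case True
    have *: "\<phi> \<in> spectral_domain (star (s * t) * (s * t)) \<longleftrightarrow> ?\<psi> \<in> spectral_domain (star s * s)"
      using True spectral_action_in_domain[OF True] star_mult_self_idempotent(1)[of s]
      by (simp add: st spectral_domain_def)
    have "(\<lambda>e\<in>idempotents. ?\<psi> (star s * e * s)) = (\<lambda>e\<in>idempotents. \<phi> (star (s * t) * e * (s * t)))"
      by (rule restrict_ext) (use conjugate_idempotent[of _ s] in \<open>simp add: star_mult mult.assoc\<close>)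
    then show ?thesis
      using True * by (simp add: spectral_action_def)
  next
    case False
    then have "\<phi> \<notin> spectral_domain (star (s * t) * (s * t))"
      using character_mult[OF _ idem star_mult_self_idempotent(1)[of t], of \<phi>] le
      unfolding st spectral_domain_def by auto
    then show ?thesis
      using False by (simp add: spectral_action_def)
  qed
qed

section \<open>The topology of the spectrum and ampleness of the spectral action\<close>

lemma topspace_spectrum: "topspace spectrum = characters"
  by (auto simp: spectrum_def characters_def PiE_def)

lemma continuous_map_spectrum_eval:
  "e \<in> idempotents \<Longrightarrow> continuous_map spectrum (discrete_topology UNIV) (\<lambda>\<phi>. \<phi> e)"
  unfolding spectrum_def
  by (intro continuous_map_from_subtopology continuous_map_product_projection)

lemma openin_spectrum_eval:
  assumes "e \<in> idempotents"
  shows "openin spectrum {\<phi> \<in> characters. \<phi> e = b}"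
  using openin_continuous_map_preimage[OF continuous_map_spectrum_eval[OF assms], of "{b}"]
  by (simp add: topspace_spectrum)

lemma openin_spectral_domain: "e \<in> idempotents \<Longrightarrow> openin spectrum (spectral_domain e)"
  using openin_spectrum_eval[of e True] by (simp add: spectral_domain_def)

text \<open>The cube is compact by Tychonoff. Prescribing the value 1 at \<open>e\<close> makes a
  homomorphism non-zero, so \<open>spectral_domain e\<close> is cut out of the cube by closed
  conditions alone.\<close>

lemma compactin_spectral_domain:
  assumes e: "e \<in> idempotents"
  shows "compactin spectrum (spectral_domain e)"
proof -
  let ?P = "product_topology (\<lambda>e. discrete_topology (UNIV :: bool set)) (idempotents :: 'a set)"
  let ?A = "\<lambda>f b. {\<phi> \<in> extensional idempotents. \<phi> f = b}"
  have top: "topspace ?P = extensional idempotents"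
    by (simp add: PiE_def)
  have A: "closedin ?P (?A f b)" if "f \<in> idempotents" for f b
    using closedin_continuous_map_preimage[OF continuous_map_product_projection[OF that], of "\<lambda>e. discrete_topology UNIV" "{b}"]
    unfolding top by simp
  \<comment> \<open>The condition involves three coordinates only, so it is a finite Boolean
    combination of closed coordinate conditions.\<close>
  have hom: "closedin ?P {\<phi> \<in> extensional idempotents. \<phi> (f * g) \<longleftrightarrow> \<phi> f \<and> \<phi> g}"
    if fg: "f \<in> idempotents" "g \<in> idempotents" for f g
  proof -
    have "{\<phi> \<in> extensional idempotents. \<phi> (f * g) \<longleftrightarrow> \<phi> f \<and> \<phi> g} =
        (?A (f * g) True \<inter> ?A f True \<inter> ?A g True) \<union> (?A (f * g) False \<inter> (?A f False \<union> ?A g False))"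
      by auto
    moreover have "closedin ?P \<dots>"
      by (intro closedin_Un closedin_Int A idempotents_mult fg)
    ultimately show ?thesis
      by (simp only:)
  qed
  let ?\<C> = "insert (?A e True)
    {{\<phi> \<in> extensional idempotents. \<phi> (f * g) \<longleftrightarrow> \<phi> f \<and> \<phi> g} | f g. f \<in> idempotents \<and> g \<in> idempotents}"
  have "closedin ?P (\<Inter>?\<C>)"
    using A[OF e, of True] hom by (intro closedin_Inter) auto
  moreover have "\<Inter>?\<C> = spectral_domain e"
    using e by (auto simp: spectral_domain_def characters_def)
  moreover have "compact_space ?P"
    by (simp add: compact_space_product_topology compact_space_discrete_topology)
  ultimately have "compactin ?P (spectral_domain e)"
    by (metis closedin_compact_space)
  then show ?thesis
    by (auto simp: spectrum_def compactin_subtopology spectral_domain_def)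
qed

lemma Hausdorff_spectrum: "Hausdorff_space spectrum"
  unfolding spectrum_def
  by (intro Hausdorff_space_subtopology) (simp add: Hausdorff_space_product_topology)

lemma characters_eq_Union: "characters = (\<Union>e\<in>idempotents. spectral_domain e)"
  by (auto simp: spectral_domain_def characters_def)

lemma locally_compact_spectrum: "locally_compact_space spectrum"
  unfolding locally_compact_space_def topspace_spectrum characters_eq_Union
  using openin_spectral_domain compactin_spectral_domain by blast

text \<open>A cylinder around \<open>\<phi>\<close> constrains finitely many coordinates. Fixing the
  values of \<open>\<phi>\<close> there gives a clopen set, which becomes compact when cut down to
  some \<open>spectral_domain e\<close> containing \<open>\<phi>\<close>.\<close>

lemma spectrum_compact_open_basis:
  assumes U: "openin spectrum U" and "\<phi> \<in> U"
  shows "\<exists>V. openin spectrum V \<and> compactin spectrum V \<and> \<phi> \<in> V \<and> V \<subseteq> U"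
proof -
  let ?P = "product_topology (\<lambda>e. discrete_topology (UNIV :: bool set)) (idempotents :: 'a set)"
  have \<phi>: "\<phi> \<in> characters"
    using assms openin_subset topspace_spectrum by blast
  then obtain e where e: "e \<in> idempotents" "\<phi> \<in> spectral_domain e"
    unfolding characters_eq_Union by blast
  obtain W where W: "openin ?P W" "U = W \<inter> characters"
    using U unfolding spectrum_def openin_subtopology by blast
  then obtain B where B: "finite {i. B i \<noteq> UNIV}" "\<phi> \<in> Pi\<^sub>E idempotents B" "Pi\<^sub>E idempotents B \<subseteq> W"
    using product_topology_open_contains_basis[OF W(1), of \<phi>] \<open>\<phi> \<in> U\<close> by auto
  define N where "N = {i \<in> idempotents. B i \<noteq> UNIV}"
  have N: "finite N" "N \<subseteq> idempotents"
    using B(1) by (auto simp: N_def)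
  \<comment> \<open>Inserting \<open>spectral_domain e\<close> also keeps the intersection
    nonvacuous when \<open>N\<close> is empty.\<close>
  define V where "V = \<Inter>(insert (spectral_domain e) ((\<lambda>i. {\<psi> \<in> characters. \<psi> i = \<phi> i}) ` N))"
  have cl: "closedin spectrum {\<psi> \<in> characters. \<psi> i = b}" if "i \<in> idempotents" for i b
    using closedin_continuous_map_preimage[OF continuous_map_spectrum_eval[OF that], of "{b}"]
    by (simp add: topspace_spectrum)
  have "openin spectrum V"
    unfolding V_def using N e openin_spectral_domain openin_spectrum_eval
    by (intro openin_Inter) auto
  moreover have "closedin spectrum V"
    unfolding V_def using N cl e compactin_imp_closedin[OF Hausdorff_spectrum compactin_spectral_domain]
    by (intro closedin_Inter) auto
  then have "compactin spectrum V"
    using compactin_spectral_domain[OF e(1)] by (rule closed_compactin[rotated 2]) (auto simp: V_def)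
  moreover have "\<phi> \<in> V"
    using \<phi> e by (simp add: V_def)
  moreover have "V \<subseteq> U"
  proof
    fix \<psi> assume \<psi>: "\<psi> \<in> V"
    then have ch: "\<psi> \<in> characters" and eq: "\<And>i. i \<in> N \<Longrightarrow> \<psi> i = \<phi> i"
      by (auto simp: V_def spectral_domain_def)
    have "\<psi> i \<in> B i" if "i \<in> idempotents" for i
      using that eq[of i] B(2) by (cases "i \<in> N") (auto simp: N_def)
    then have "\<psi> \<in> Pi\<^sub>E idempotents B"
      using ch by (auto simp: characters_def PiE_iff)
    then show "\<psi> \<in> U"
      using B(3) W(2) ch by blast
  qed
  ultimately show ?thesis by blast
qed

text \<open>Each coordinate of the image is evaluation of \<open>\<phi>\<close> at the fixed
  idempotent \<open>star s * e * s\<close>.\<close>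

lemma continuous_map_spectral_action:
  "continuous_map (subtopology spectrum (spectral_domain (star s * s)))
    (subtopology spectrum (spectral_domain (s * star s))) (\<lambda>\<phi>. the (spectral_action s \<phi>))"
    (is "continuous_map ?X _ _")
proof -
  let ?f = "\<lambda>\<phi>. \<lambda>e\<in>idempotents. \<phi> (star s * e * s)"
  have top: "topspace ?X = spectral_domain (star s * s)"
    by (auto simp: topspace_spectrum spectral_domain_def)
  have "continuous_map ?X (product_topology (\<lambda>e. discrete_topology UNIV) idempotents) ?f"
    unfolding continuous_map_componentwise
  proof (intro conjI ballI)
    fix e :: 'a assume e: "e \<in> idempotents"
    have "continuous_map ?X (discrete_topology UNIV) (\<lambda>\<phi>. \<phi> (star s * e * s))"
      by (intro continuous_map_from_subtopology continuous_map_spectrum_eval conjugate_idempotent e)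
    then show "continuous_map ?X (discrete_topology UNIV) (\<lambda>\<phi>. ?f \<phi> e)"
      using e by simp
  qed auto
  moreover have "?f ` topspace ?X \<subseteq> spectral_domain (s * star s)"
    unfolding top using spectral_action_in_domain by blast
  moreover have "spectral_domain (s * star s) \<subseteq> characters"
    by (auto simp: spectral_domain_def)
  ultimately have "continuous_map ?X (subtopology spectrum (spectral_domain (s * star s))) ?f"
    unfolding spectrum_def by (auto simp: continuous_map_in_subtopology)
  then show ?thesis
    by (rule continuous_map_eq) (simp add: spectral_action_def top del: topspace_subtopology)
qed

lemma semigroup_action_spectral: "semigroup_action spectrum spectral_action"
  unfolding semigroup_action_def
proof (intro conjI allI spectral_action_mult)
  fix s :: 'a
  let ?g = "\<lambda>s \<phi>. the (spectral_action s \<phi>)"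
  have top: "topspace (subtopology spectrum (spectral_domain e)) = spectral_domain e" for e :: 'a
    by (auto simp: topspace_spectrum spectral_domain_def)
  have "homeomorphic_maps (subtopology spectrum (spectral_domain (star s * s)))
      (subtopology spectrum (spectral_domain (s * star s))) (?g s) (?g (star s))"
    unfolding homeomorphic_maps_def top
    using continuous_map_spectral_action[of s] continuous_map_spectral_action[of "star s"]
      spectral_action_star[of _ s] spectral_action_star[of _ "star s"] by simp
  then show "spectral_action s \<in> partial_homeos spectrum"
    by (simp add: partial_homeos_def dom_spectral_action ran_spectral_action homeomorphic_maps_imp_map openin_spectral_domain star_mult_self_idempotent)
qed

lemma dom_spectral_action_idempotent:
  "e \<in> idempotents \<Longrightarrow> dom (spectral_action e) = spectral_domain e"
  by (simp add: dom_spectral_action star_idempotent idempotent_mult_self)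

lemma ample_action_spectral: "ample_action spectrum spectral_action"
  unfolding ample_action_def nondegenerate_action_def
proof (intro conjI semigroup_action_spectral exI)
  show "topspace spectrum = (\<Union>e\<in>idempotents. dom (spectral_action e))"
    by (simp add: topspace_spectrum characters_eq_Union dom_spectral_action_idempotent)
  show "\<forall>V\<in>{V. openin spectrum V \<and> compactin spectrum V}. openin spectrum V \<and> compactin spectrum V"
    by blast
  show "\<forall>U x. openin spectrum U \<and> x \<in> U \<longrightarrow>
      (\<exists>V\<in>{V. openin spectrum V \<and> compactin spectrum V}. x \<in> V \<and> V \<subseteq> U)"
    using spectrum_compact_open_basis by blast
  show "\<forall>e\<in>idempotents. compactin spectrum (dom (spectral_action e)) \<and> openin spectrum (dom (spectral_action e))"
    by (simp add: dom_spectral_action_idempotent openin_spectral_domain compactin_spectral_domain)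
qed

section \<open>Principal characters and the converse direction\<close>

text \<open>For idempotent \<open>f\<close>, this is the indicator of the principal filter of
  idempotents above \<open>f\<close>.\<close>

definition principal_character :: "'s::inverse_semigroup \<Rightarrow> 's \<Rightarrow> bool" where
  "principal_character f = (\<lambda>e\<in>idempotents. f * e = f)"

lemma principal_character_in_spectral_domain:
  assumes f: "f \<in> idempotents" and g: "g \<in> idempotents"
  shows "principal_character f \<in> spectral_domain g \<longleftrightarrow> f * g = f"
proof -
  have "f * (e * h) = f \<longleftrightarrow> f * e = f \<and> f * h = f" if "e \<in> idempotents" "h \<in> idempotents" for e h
    using that by (metis idempotent_mult_self idempotents_commute mult.assoc)
  then have "principal_character f \<in> characters"
    using f by (auto simp: principal_character_def characters_def idempotents_mult intro: idempotent_mult_self)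
  then show ?thesis
    using g by (simp add: spectral_domain_def principal_character_def)
qed

text \<open>Restrictions of one element are ordered as soon as their domain idempotents are: the
  common restriction of \<open>u\<close> and \<open>v\<close> is then \<open>v\<close>
  itself.\<close>

lemma natural_le_of_common_upper_bound:
  fixes u v s :: "'s::inverse_semigroup"
  assumes u: "natural_le u s" and v: "natural_le v s"
    and uv: "(star v * v) * (star u * u) = star v * v"
  shows "natural_le v u"
  using natural_le_common_restriction(1)[OF u v] natural_le_eq[OF v] uv
    idempotents_commute[OF star_mult_self_idempotent(1)[of v] star_mult_self_idempotent(1)[of u]]
  by metis

lemma weak_semilattice_of_Hausdorff_universal_groupoid:
  assumes "Hausdorff_space (germ_topology spectrum
    (spectral_action :: 's::inverse_semigroup \<Rightarrow> ('s \<Rightarrow> bool) \<Rightarrow> ('s \<Rightarrow> bool) option))"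
  shows "weak_semilattice (natural_le :: 's \<Rightarrow> 's \<Rightarrow> bool)"
  unfolding weak_semilattice_def
proof (intro allI)
  fix s t :: 's
  let ?L = "{u. natural_le u s \<and> natural_le u t}"
  let ?D = "\<lambda>u. spectral_domain (star u * u)"
  have dom: "dom (spectral_action (star u * u)) = ?D u" for u :: 's
    by (simp add: dom_spectral_action_idempotent star_mult_self_idempotent)
  have "?D s \<inter> ?D t = spectral_domain ((star s * s) * (star t * t))"
    by (auto simp: spectral_domain_def character_mult star_mult_self_idempotent)
  then have "compactin spectrum (?D s \<inter> ?D t)"
    by (simp add: compactin_spectral_domain idempotents_mult star_mult_self_idempotent)
  moreover have "closedin (subtopology spectrum (?D s \<inter> ?D t)) (\<Union>u\<in>?L. ?D u)"
    using closedin_germ_equalizer[OF semigroup_action_spectral assms, of s t] by (simp only: dom)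
  ultimately have "compactin (subtopology spectrum (?D s \<inter> ?D t)) (\<Union>u\<in>?L. ?D u)"
    using closedin_compact_space compact_space_subtopology by blast
  then have "compactin spectrum (\<Union>u\<in>?L. ?D u)"
    by (simp only: compactin_subtopology)
  \<comment> \<open>The compact union is covered by the very open sets that form it.\<close>
  then have "\<exists>\<F>. finite \<F> \<and> \<F> \<subseteq> ?D ` ?L \<and> (\<Union>u\<in>?L. ?D u) \<subseteq> \<Union>\<F>"
    by (rule compactinD) (auto intro: openin_spectral_domain star_mult_self_idempotent)
  then obtain \<F> where \<F>: "finite \<F>" "\<F> \<subseteq> ?D ` ?L" "(\<Union>u\<in>?L. ?D u) \<subseteq> \<Union>\<F>"
    by blast
  obtain F where F: "finite F" "F \<subseteq> ?L" "(\<Union>u\<in>?L. ?D u) \<subseteq> (\<Union>u\<in>F. ?D u)"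
    using finite_subset_image[OF \<F>(1,2)] \<F>(3) by auto
  have "natural_le v s \<and> natural_le v t \<longleftrightarrow> (\<exists>u\<in>F. natural_le v u)" for v
  proof
    assume v: "natural_le v s \<and> natural_le v t"
    \<comment> \<open>This character turns the covering of sets into an inequality of idempotents:
      its membership in \<open>?D u\<close> means that \<open>star v * v\<close> lies below
      \<open>star u * u\<close>.\<close>
    have "principal_character (star v * v) \<in> ?D v"
      by (simp only: principal_character_in_spectral_domain star_mult_self_idempotent idempotent_mult_self)
    then obtain u where u: "u \<in> F" "principal_character (star v * v) \<in> ?D u"
      using F(3) v by blast
    then have "(star v * v) * (star u * u) = star v * v"
      by (simp only: principal_character_in_spectral_domain star_mult_self_idempotent)
    then have "natural_le v u"
      using natural_le_of_common_upper_bound[of u s v] F(2) u(1) v by blast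
    then show "\<exists>u\<in>F. natural_le v u"
      using u(1) by blast
  next
    assume "\<exists>u\<in>F. natural_le v u"
    then show "natural_le v s \<and> natural_le v t"
      using F(2) natural_le_trans by blast
  qed
  then have "principal_downset natural_le s \<inter> principal_downset natural_le t =
      (\<Union>u\<in>F. principal_downset natural_le u)"
    by (auto simp: principal_downset_def)
  then show "\<exists>F. finite F \<and> principal_downset natural_le s \<inter> principal_downset natural_le t =
      (\<Union>r\<in>F. principal_downset natural_le r)"
    using F(1) by blast
qed

section \<open>Clopen and ample actions, and the equivalences\<close>

lemma Hausdorff_germ_groupoid_clopen:
  fixes \<theta> :: "'s::inverse_semigroup \<Rightarrow> 'x \<Rightarrow> 'x option"
  assumes "weak_semilattice (natural_le :: 's \<Rightarrow> 's \<Rightarrow> bool)"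
    and "Hausdorff_space X" and "nondegenerate_action X \<theta>"
    and "\<forall>e\<in>idempotents. openin X (dom (\<theta> e)) \<and> closedin X (dom (\<theta> e))"
  shows "Hausdorff_groupoid (germ_groupoid X \<theta>)"
  using assms unfolding nondegenerate_action_def Hausdorff_groupoid_def germ_groupoid_def
  by (auto intro: Hausdorff_germ_topology)

text \<open>Compact sets in a Hausdorff space are closed, so the ample case is an instance of the
  clopen one.\<close>

lemma ample_action_imp_clopen:
  assumes "Hausdorff_space X" and "ample_action X \<theta>"
  shows "nondegenerate_action X \<theta>"
    and "\<forall>e\<in>idempotents. openin X (dom (\<theta> e)) \<and> closedin X (dom (\<theta> e))"
  using assms compactin_imp_closedin unfolding ample_action_def by blast+

(* HOL cannot quantify over types inside a formula, so each condition on "all spaces X" occurs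
   twice: as a condition equivalent to being a weak semilattice, for spaces on the type
   's => bool (where the spectrum of the idempotents lives); and as a consequence of being a
   weak semilattice, for spaces on an arbitrary type 'x. *)
theorem theorem4p20:
  shows
    "(weak_semilattice (natural_le :: 's::inverse_semigroup \<Rightarrow> 's \<Rightarrow> bool) \<longleftrightarrow>
        (\<forall>(X :: ('s \<Rightarrow> bool) topology) (\<theta> :: 's \<Rightarrow> ('s \<Rightarrow> bool) \<Rightarrow> ('s \<Rightarrow> bool) option).
           locally_compact_space X \<and> Hausdorff_space X \<and> nondegenerate_action X \<theta> \<and>
           (\<forall>e\<in>idempotents. openin X (dom (\<theta> e)) \<and> closedin X (dom (\<theta> e))) \<longrightarrow>
           Hausdorff_groupoid (germ_groupoid X \<theta>))) \<and>
     (weak_semilattice (natural_le :: 's \<Rightarrow> 's \<Rightarrow> bool) \<longrightarrow>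
        (\<forall>(X :: 'x topology) (\<theta> :: 's \<Rightarrow> 'x \<Rightarrow> 'x option).
           locally_compact_space X \<and> Hausdorff_space X \<and> nondegenerate_action X \<theta> \<and>
           (\<forall>e\<in>idempotents. openin X (dom (\<theta> e)) \<and> closedin X (dom (\<theta> e))) \<longrightarrow>
           Hausdorff_groupoid (germ_groupoid X \<theta>))) \<and>
     (weak_semilattice (natural_le :: 's \<Rightarrow> 's \<Rightarrow> bool) \<longleftrightarrow>
        Hausdorff_groupoid (universal_groupoid :: ('s \<times> ('s \<Rightarrow> bool)) set topological_groupoid)) \<and>
     (weak_semilattice (natural_le :: 's \<Rightarrow> 's \<Rightarrow> bool) \<longleftrightarrow>
        (\<forall>(X :: ('s \<Rightarrow> bool) topology) (\<theta> :: 's \<Rightarrow> ('s \<Rightarrow> bool) \<Rightarrow> ('s \<Rightarrow> bool) option).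
           locally_compact_space X \<and> Hausdorff_space X \<and> ample_action X \<theta> \<longrightarrow>
           Hausdorff_groupoid (germ_groupoid X \<theta>))) \<and>
     (weak_semilattice (natural_le :: 's \<Rightarrow> 's \<Rightarrow> bool) \<longrightarrow>
        (\<forall>(X :: 'x topology) (\<theta> :: 's \<Rightarrow> 'x \<Rightarrow> 'x option).
           locally_compact_space X \<and> Hausdorff_space X \<and> ample_action X \<theta> \<longrightarrow>
           Hausdorff_groupoid (germ_groupoid X \<theta>)))"
proof -
  note clopen = Hausdorff_germ_groupoid_clopen
  note ample = clopen[OF _ _ ample_action_imp_clopen]
  have universal: "weak_semilattice (natural_le :: 's \<Rightarrow> 's \<Rightarrow> bool)"
    if "Hausdorff_groupoid (germ_groupoid spectrum
      (spectral_action :: 's \<Rightarrow> ('s \<Rightarrow> bool) \<Rightarrow> ('s \<Rightarrow> bool) option))"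
    using that weak_semilattice_of_Hausdorff_universal_groupoid
    by (simp add: Hausdorff_groupoid_def germ_groupoid_def)
  \<comment> \<open>These facts let both the clopen and the ample condition be instantiated at the
    spectral action, whose germ groupoid is the one \<open>universal\<close> requires to be
    Hausdorff.\<close>
  note spec = locally_compact_spectrum Hausdorff_spectrum ample_action_spectral
    ample_action_imp_clopen[OF Hausdorff_spectrum ample_action_spectral]
  show ?thesis
    unfolding universal_groupoid_def
    apply (intro conjI iffI allI impI; (elim conjE)?)
    subgoal by (rule clopen)
    subgoal by (rule universal) (use spec in blast)
    subgoal by (rule clopen)
    subgoal by (rule clopen[OF _ Hausdorff_spectrum spec(4,5)])
    subgoal by (rule universal)
    subgoal by (rule ample)
    subgoal by (rule universal) (use spec in blast)
    subgoal by (rule ample)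
    done
qed

end
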